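(* Let $\mathscr{G} = (\mathscr{V}, \mathscr{E})$ be a finite connected graph with $N \ge 2$ vertices, let $\rho_x > 0$ for $x \in \mathscr{V}$, and let $(\eta_t)_{t \ge 0}$ be the simple exclusion process on $\mathscr{G}$ with rates $(\rho_x)_{x \in \mathscr{V}}$. For all $0 < K \le N$ and $x \in \mathscr{V}$, the limit $$ p_K(x) = \lim_{t \to \infty} P(x \in \eta_t \mid \operatorname{card}(\eta_0) = K) $$ exists, depends on the initial configuration only through its number $K$ of particles, and is given by $$ p_K(x) = \frac{\Sigma(\Lambda_K^+(x))}{\Sigma(\Lambda_K)}. $$ In particular, for each $0 < K \le N$, the limits $p_K(x)$, $x \in \mathscr{V}$, are characterized by (that is, they satisfy, and are the only numbers satisfying) $$ \frac{p_K(x)}{p_K(y)} = \frac{\Sigma(\Lambda_K^+(x))}{\Sigma(\Lambda_K^+(y))} \ \text{ for all } x, y \in \mathscr{V} \quad \text{and} \quad \sum_{z \in \mathscr{V}} p_K(z) = K. $$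
   Context: Graphs are undirected, without loops or multiple edges; $\deg(x)$ is the degree of $x$. A configuration is a map $\eta : \mathscr{V} \to \{0,1\}$, where $\eta(x) = 1$ means that $x$ is occupied by a particle and $\eta(x) = 0$ that $x$ is empty. A configuration $\eta$ is identified with the subset $\{x \in \mathscr{V} : \eta(x) = 1\}$ of $\mathscr{V}$. For $x, y \in \mathscr{V}$, $\tau_{x,y}\eta$ is the configuration obtained from $\eta$ by exchanging the states at $x$ and $y$. The simple exclusion process with rates $(\rho_x)$ is the continuous-time Markov chain $(\eta_t)_{t\ge 0}$ on $\{0,1\}^{\mathscr{V}}$ that jumps from $\eta$ to $\xi \ne \eta$ at rate $q(\eta,\xi) = \rho_x/\deg(x)$ if $\xi = \tau_{x,y}\eta$ for some edge $(x,y) \in \mathscr{E}$ with $\eta(x) = 1$ (hence $\eta(y) = 0$), and at rate $q(\eta,\xi) = 0$ otherwise. In words, the particle at $x$, if there is one, chooses a neighbor of $x$ uniformly at random at rate $\rho_x$ and jumps there if and only if it is empty. $\Lambda_K$ is the set of configurations with exactly $K$ particles, and $\Lambda_K^+(x) = \{\eta \in \Lambda_K : x \in \eta\}$. For $z \in \mathscr{V}$, $\eta \subset \mathscr{V}$, and a collection $\mathscr{C}$ of subsets of $\mathscr{V}$, $$ D(z) = \frac{\deg(z)}{\rho_z}, \quad D(\eta) = \prod_{z \in \eta} D(z), \quad \Sigma(\mathscr{C}) = \sum_{\eta \in \mathscr{C}} D(\eta). $$ *)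

theory Defs
  imports
    "HOL-Probability.Probability"
    "HOL-Combinatorics.Transposition"
    "Graph_Theory.Pair_Digraph"
    "Graph_Theory.Digraph_Component"
begin

section \<open>Continuous-time Markov chains on a finite state space\<close>

definition transition_function :: "'s set \<Rightarrow> (real \<Rightarrow> 's \<Rightarrow> 's \<Rightarrow> real) \<Rightarrow> bool" where
  "transition_function S P \<longleftrightarrow>
     (\<forall>t\<ge>0. \<forall>\<eta>\<in>S. \<forall>\<xi>\<in>S. 0 \<le> P t \<eta> \<xi>) \<and>
     (\<forall>t\<ge>0. \<forall>\<eta>\<in>S. (\<Sum>\<xi>\<in>S. P t \<eta> \<xi>) = 1) \<and>
     (\<forall>\<eta>\<in>S. \<forall>\<xi>\<in>S. P 0 \<eta> \<xi> = (if \<eta> = \<xi> then 1 else 0)) \<and>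
     (\<forall>s\<ge>0. \<forall>t\<ge>0. \<forall>\<eta>\<in>S. \<forall>\<xi>\<in>S. P (s + t) \<eta> \<xi> = (\<Sum>\<zeta>\<in>S. P s \<eta> \<zeta> * P t \<zeta> \<xi>))"

text \<open>
  The rate condition \<open>P h \<eta> \<xi> = q \<eta> \<xi> * h + o(h)\<close> as \<open>h\<close> decreases to \<open>0\<close> is imposed only for
  \<open>\<xi> \<noteq> \<eta>\<close>; diagonal values of \<open>q\<close> are never used.  On a finite state space the derivative
  of \<open>P h \<eta> \<eta>\<close> at \<open>0\<close> is then determined, because each \<open>P h\<close> is a stochastic matrix.
\<close>
definition has_jump_rates ::
    "'s set \<Rightarrow> (real \<Rightarrow> 's \<Rightarrow> 's \<Rightarrow> real) \<Rightarrow> ('s \<Rightarrow> 's \<Rightarrow> real) \<Rightarrow> bool" where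
  "has_jump_rates S P q \<longleftrightarrow>
     (\<forall>\<eta>\<in>S. \<forall>\<xi>\<in>S. \<xi> \<noteq> \<eta> \<longrightarrow> ((\<lambda>h. P h \<eta> \<xi> / h) \<longlongrightarrow> q \<eta> \<xi>) (at_right 0))"

text \<open>
  The law of \<open>X 0\<close> is arbitrary.  Right-continuity with respect to the discrete topology on \<open>S\<close>
  says that the path stays constant for a positive time after each time \<open>t\<close>.
\<close>
locale markov_chain = prob_space M
  for M :: "'w measure" and S :: "'s set" and q :: "'s \<Rightarrow> 's \<Rightarrow> real"
    and X :: "real \<Rightarrow> 'w \<Rightarrow> 's" +
  assumes finite_states: "finite S"
    and measurable_states: "0 \<le> t \<Longrightarrow> X t \<in> measurable M (count_space S)"
    and markov_property:
      "\<exists>P. transition_function S P \<and> has_jump_rates S P q \<and>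
         (\<forall>(n::nat) (t :: nat \<Rightarrow> real) (\<eta> :: nat \<Rightarrow> 's).
            0 \<le> t 0 \<and> (\<forall>i\<le>n. t i < t (Suc i)) \<and> (\<forall>i\<le>Suc n. \<eta> i \<in> S) \<and>
            \<P>(\<omega> in M. \<forall>i\<le>n. X (t i) \<omega> = \<eta> i) > 0 \<longrightarrow>
            \<P>(\<omega> in M. X (t (Suc n)) \<omega> = \<eta> (Suc n) \<bar> \<forall>i\<le>n. X (t i) \<omega> = \<eta> i)
              = P (t (Suc n) - t n) (\<eta> n) (\<eta> (Suc n)))"
    and right_continuous_paths:
      "AE \<omega> in M. \<forall>t\<ge>0. \<forall>\<^sub>F s in at_right t. X s \<omega> = X t \<omega>"

section \<open>The simple exclusion process\<close>

text \<open>
  As in the Graph_Theory library, an undirected simple graph is a finite loop-free digraph with a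
  symmetric set of arcs, so that the degree of a vertex is its out-degree.
  A configuration is the set of its occupied vertices.
\<close>
abbreviation deg :: "'v pair_pre_digraph \<Rightarrow> 'v \<Rightarrow> nat" where
  "deg G x \<equiv> out_degree (with_proj G) x"

definition exchange :: "'v \<Rightarrow> 'v \<Rightarrow> 'v set \<Rightarrow> 'v set" where
  "exchange x y \<eta> = Transposition.transpose x y ` \<eta>"

lemma mem_exchange_iff: "z \<in> exchange x y \<eta> \<longleftrightarrow> Transposition.transpose x y z \<in> \<eta>"
  unfolding exchange_def by (metis (no_types) imageE image_eqI transpose_involutory)

text \<open>The sum has at most one term, cf. the two lemmas after the definition.\<close>
definition exclusion_rate ::
    "'v pair_pre_digraph \<Rightarrow> ('v \<Rightarrow> real) \<Rightarrow> 'v set \<Rightarrow> 'v set \<Rightarrow> real" where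
  "exclusion_rate G \<rho> \<eta> \<xi> =
     (\<Sum>(x, y) \<in> {(x, y) \<in> parcs G. x \<in> \<eta> \<and> y \<notin> \<eta> \<and> \<xi> = exchange x y \<eta>}. \<rho> x / deg G x)"

lemma exchange_diff:
  assumes "x \<in> \<eta>" "y \<notin> \<eta>"
  shows "\<eta> - exchange x y \<eta> = {x}" "exchange x y \<eta> - \<eta> = {y}"
  using assms by (auto simp: mem_exchange_iff Transposition.transpose_def split: if_splits)

lemma exclusion_rate_edge:
  assumes "(x, y) \<in> parcs G" "x \<in> \<eta>" "exchange x y \<eta> \<noteq> \<eta>"
  shows "exclusion_rate G \<rho> \<eta> (exchange x y \<eta>) = \<rho> x / deg G x"
proof -
  have y: "y \<notin> \<eta>"
  proof
    assume "y \<in> \<eta>"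
    then have "exchange x y \<eta> = \<eta>"
      using assms(2) by (auto simp: mem_exchange_iff Transposition.transpose_def split: if_splits)
    with assms(3) show False by blast
  qed
  have "{(x', y'). (x', y') \<in> parcs G \<and> x' \<in> \<eta> \<and> y' \<notin> \<eta> \<and> exchange x y \<eta> = exchange x' y' \<eta>} = {(x, y)}"
  proof (intro equalityI subsetI)
    fix e assume "e \<in> {(x', y'). (x', y') \<in> parcs G \<and> x' \<in> \<eta> \<and> y' \<notin> \<eta> \<and> exchange x y \<eta> = exchange x' y' \<eta>}"
    then obtain x' y' where e: "e = (x', y')" "x' \<in> \<eta>" "y' \<notin> \<eta>" "exchange x y \<eta> = exchange x' y' \<eta>"
      by blast
    then have "{x'} = {x}" "{y'} = {y}"
      using exchange_diff[OF assms(2) y] exchange_diff[OF e(2,3)] by simp_all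
    with e show "e \<in> {(x, y)}" by simp
  qed (use assms y in auto)
  then show ?thesis
    by (simp add: exclusion_rate_def)
qed

lemma exclusion_rate_eq_0:
  assumes "\<not> (\<exists>x y. (x, y) \<in> parcs G \<and> x \<in> \<eta> \<and> \<xi> = exchange x y \<eta>)"
  shows "exclusion_rate G \<rho> \<eta> \<xi> = 0"
proof -
  have "{(x, y). (x, y) \<in> parcs G \<and> x \<in> \<eta> \<and> y \<notin> \<eta> \<and> \<xi> = exchange x y \<eta>} = {}"
    using assms by blast
  then show ?thesis
    unfolding exclusion_rate_def by (simp only: sum.empty)
qed

definition simple_exclusion_process ::
    "'v pair_pre_digraph \<Rightarrow> ('v \<Rightarrow> real) \<Rightarrow> 'w measure \<Rightarrow> (real \<Rightarrow> 'w \<Rightarrow> 'v set) \<Rightarrow> bool" where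
  "simple_exclusion_process G \<rho> M X \<longleftrightarrow>
     markov_chain M (Pow (pverts G)) (exclusion_rate G \<rho>) X"

definition configs :: "'v pair_pre_digraph \<Rightarrow> nat \<Rightarrow> 'v set set" where
  "configs G K = {\<eta>. \<eta> \<subseteq> pverts G \<and> card \<eta> = K}"

definition configs_at :: "'v pair_pre_digraph \<Rightarrow> nat \<Rightarrow> 'v \<Rightarrow> 'v set set" where
  "configs_at G K x = {\<eta> \<in> configs G K. x \<in> \<eta>}"

definition site_weight :: "'v pair_pre_digraph \<Rightarrow> ('v \<Rightarrow> real) \<Rightarrow> 'v \<Rightarrow> real" where
  "site_weight G \<rho> z = deg G z / \<rho> z"

definition config_weight :: "'v pair_pre_digraph \<Rightarrow> ('v \<Rightarrow> real) \<Rightarrow> 'v set \<Rightarrow> real" where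
  "config_weight G \<rho> \<eta> = (\<Prod>z\<in>\<eta>. site_weight G \<rho> z)"

definition total_weight :: "'v pair_pre_digraph \<Rightarrow> ('v \<Rightarrow> real) \<Rightarrow> 'v set set \<Rightarrow> real" where
  "total_weight G \<rho> C = (\<Sum>\<eta>\<in>C. config_weight G \<rho> \<eta>)"

end

theory Submission
  imports Defs
begin

text \<open>
  The weights \<open>D(\<eta>)\<close> satisfy detailed balance: if a particle jumps along an edge from \<open>x\<close> to
  \<open>y\<close>, turning \<open>\<eta>\<close> into \<open>\<xi>\<close>, then \<open>D(\<eta>) \<rho>\<^sub>x / deg(x)\<close> and \<open>D(\<xi>) \<rho>\<^sub>y / deg(y)\<close> are both the
  product of the site weights over the particles that do not move
  (\<open>detailed_balance_move\<close>).  The number of particles is conserved, and on a connected graph any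
  two configurations with equally many particles communicate (\<open>configs_communicate\<close>).  Hence, for
  each \<open>K\<close>, the weights normalized to total mass one on the configurations with \<open>K\<close> particles are
  the equilibrium to which the process converges from each such configuration, and the limiting
  probability of a particle at \<open>x\<close> is the equilibrium mass of the configurations containing \<open>x\<close>.

  The convergence theorem behind this (\<open>tendsto_stationary\<close>) is about transition functions of
  which only the Chapman-Kolmogorov equations and the rates at time \<open>0\<close> are given.  Forward and
  backward equations are avoided.  Stationarity of a reversible \<open>\<pi>\<close> is obtained from
  subadditivity: the \<open>l\<^sup>1\<close>-distance between \<open>\<pi> P\<^sub>t\<close> and \<open>\<pi>\<close> is subadditive in \<open>t\<close>, because
  stochastic matrices are contractions, and it is \<open>o(t)\<close> at \<open>0\<close>, because the flows of probability
  in both directions between two states cancel to first order; such a function vanishes.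
  Convergence follows from Doeblin's argument: on the support of \<open>\<pi>\<close> all entries of \<open>P\<^sub>1\<close> are
  positive, so \<open>P\<^sub>1 \<ge> \<delta> \<pi>\<close> for some \<open>\<delta> > 0\<close>, and in each unit of time
  the largest deviation of a transition probability from its equilibrium value, over all initial
  states in the support, shrinks at least by the factor \<open>1 - \<delta>\<close>.

  The limits are determined by their ratios up to a common factor; the sum \<open>K\<close> fixes this factor,
  since summing \<open>\<Sigma>(\<Lambda>\<^sub>K\<^sup>+(x))\<close> over \<open>x\<close> counts each configuration once for each of its \<open>K\<close>
  particles (\<open>sum_total_weight_at\<close>).
\<close>

section \<open>Reversible transition functions on a finite state space\<close>

lemma filterlim_divide_nat_at_right_0:
  assumes "(t::real) > 0"
  shows "filterlim (\<lambda>n. t / real (Suc n)) (at_right 0) sequentially"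
proof -
  have "(\<lambda>n. t * inverse (real (Suc n))) \<longlonglongrightarrow> t * 0"
    by (intro tendsto_mult tendsto_const LIMSEQ_inverse_real_of_nat)
  then show ?thesis
    unfolding filterlim_at using assms by (simp add: divide_inverse)
qed

text \<open>
  Dividing \<open>[0, t]\<close> into \<open>n\<close> equal steps \<open>h = t / n\<close> bounds \<open>f t\<close> by \<open>n f(h) = t (f(h) / h)\<close>,
  which tends to \<open>0\<close> as \<open>n\<close> grows.
\<close>
lemma subadditive_eq_0:
  fixes f :: "real \<Rightarrow> real"
  assumes nonneg: "\<And>t. 0 \<le> t \<Longrightarrow> 0 \<le> f t"
    and subadd: "\<And>s t. 0 \<le> s \<Longrightarrow> 0 \<le> t \<Longrightarrow> f (s + t) \<le> f s + f t"
    and small: "((\<lambda>h. f h / h) \<longlongrightarrow> 0) (at_right 0)"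
    and "0 < t"
  shows "f t = 0"
proof -
  have iterate: "f (real (Suc n) * h) \<le> real (Suc n) * f h" if "0 \<le> h" for n h
  proof (induction n)
    case (Suc n)
    have "f (real (Suc (Suc n)) * h) = f (real (Suc n) * h + h)"
      by (simp add: algebra_simps)
    also have "\<dots> \<le> f (real (Suc n) * h) + f h"
      using that by (intro subadd) auto
    finally show ?case
      using Suc by (simp add: algebra_simps)
  qed simp
  have bound: "f t \<le> t * (f (t / real (Suc n)) / (t / real (Suc n)))" for n
    using iterate[of "t / real (Suc n)" n] \<open>0 < t\<close> by (simp add: mult.commute)
  have "(\<lambda>n. t * (f (t / real (Suc n)) / (t / real (Suc n)))) \<longlonglongrightarrow> t * 0"
    by (intro tendsto_mult tendsto_const
        filterlim_compose[OF small filterlim_divide_nat_at_right_0[OF \<open>0 < t\<close>]])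
  then have "f t \<le> t * 0"
    by (rule LIMSEQ_le_const) (use bound in blast)
  with nonneg[of t] \<open>0 < t\<close> show ?thesis by simp
qed

locale finite_transition_function =
  fixes S :: "'s set" and P :: "real \<Rightarrow> 's \<Rightarrow> 's \<Rightarrow> real" and q :: "'s \<Rightarrow> 's \<Rightarrow> real"
  assumes finite_S: "finite S"
    and transition: "transition_function S P"
    and rates: "has_jump_rates S P q"
begin

lemma nonneg: "0 \<le> t \<Longrightarrow> \<eta> \<in> S \<Longrightarrow> \<xi> \<in> S \<Longrightarrow> 0 \<le> P t \<eta> \<xi>"
  and total: "0 \<le> t \<Longrightarrow> \<eta> \<in> S \<Longrightarrow> (\<Sum>\<xi>\<in>S. P t \<eta> \<xi>) = 1"
  and initial: "\<eta> \<in> S \<Longrightarrow> \<xi> \<in> S \<Longrightarrow> P 0 \<eta> \<xi> = (if \<eta> = \<xi> then 1 else 0)"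
  and chapman_kolmogorov: "0 \<le> s \<Longrightarrow> 0 \<le> t \<Longrightarrow> \<eta> \<in> S \<Longrightarrow> \<xi> \<in> S \<Longrightarrow>
    P (s + t) \<eta> \<xi> = (\<Sum>\<zeta>\<in>S. P s \<eta> \<zeta> * P t \<zeta> \<xi>)"
  using transition unfolding transition_function_def by auto

lemma jump_rate:
  "\<eta> \<in> S \<Longrightarrow> \<xi> \<in> S \<Longrightarrow> \<xi> \<noteq> \<eta> \<Longrightarrow> ((\<lambda>h. P h \<eta> \<xi> / h) \<longlongrightarrow> q \<eta> \<xi>) (at_right 0)"
  using rates unfolding has_jump_rates_def by auto

lemma le_1:
  assumes "0 \<le> t" "\<eta> \<in> S" "\<xi> \<in> S"
  shows "P t \<eta> \<xi> \<le> 1"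
proof -
  have "P t \<eta> \<xi> \<le> (\<Sum>\<xi>\<in>S. P t \<eta> \<xi>)"
    using assms by (intro member_le_sum nonneg finite_S) auto
  with total assms show ?thesis by simp
qed

lemma two_step_le:
  assumes "0 \<le> s" "0 \<le> t" "\<eta> \<in> S" "\<zeta> \<in> S" "\<xi> \<in> S"
  shows "P s \<eta> \<zeta> * P t \<zeta> \<xi> \<le> P (s + t) \<eta> \<xi>"
  using assms unfolding chapman_kolmogorov[OF assms(1-3,5)]
  by (intro member_le_sum[where f = "\<lambda>\<zeta>. P s \<eta> \<zeta> * P t \<zeta> \<xi>"] mult_nonneg_nonneg nonneg finite_S) auto

lemma two_step_pos:
  assumes "0 \<le> s" "0 \<le> t" "\<eta> \<in> S" "\<zeta> \<in> S" "\<xi> \<in> S" "0 < P s \<eta> \<zeta>" "0 < P t \<zeta> \<xi>"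
  shows "0 < P (s + t) \<eta> \<xi>"
  using two_step_le[OF assms(1-5)] mult_pos_pos[OF assms(6,7)] by linarith

lemma diagonal_tendsto_1:
  assumes "\<eta> \<in> S"
  shows "((\<lambda>h. P h \<eta> \<eta>) \<longlongrightarrow> 1) (at_right 0)"
proof -
  have off: "((\<lambda>h. P h \<eta> \<xi>) \<longlongrightarrow> 0) (at_right 0)" if "\<xi> \<in> S - {\<eta>}" for \<xi>
  proof (rule Lim_transform_eventually)
    have "((\<lambda>h. P h \<eta> \<xi> / h * h) \<longlongrightarrow> q \<eta> \<xi> * 0) (at_right 0)"
      using assms that by (intro tendsto_mult jump_rate tendsto_ident_at) auto
    then show "((\<lambda>h. P h \<eta> \<xi> / h * h) \<longlongrightarrow> 0) (at_right 0)" by simp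
    show "\<forall>\<^sub>F h in at_right 0. P h \<eta> \<xi> / h * h = P h \<eta> \<xi>"
      unfolding eventually_at_filter by simp
  qed
  have "((\<lambda>h. 1 - (\<Sum>\<xi>\<in>S - {\<eta>}. P h \<eta> \<xi>)) \<longlongrightarrow> 1 - (\<Sum>\<xi>\<in>S - {\<eta>}. 0)) (at_right 0)"
    by (intro tendsto_diff tendsto_const tendsto_sum off)
  then have "((\<lambda>h. 1 - (\<Sum>\<xi>\<in>S - {\<eta>}. P h \<eta> \<xi>)) \<longlongrightarrow> 1) (at_right 0)" by simp
  moreover have "\<forall>\<^sub>F h in at_right 0. 1 - (\<Sum>\<xi>\<in>S - {\<eta>}. P h \<eta> \<xi>) = P h \<eta> \<eta>"
    using eventually_at_right_less[of 0]
  proof eventually_elim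
    case (elim h)
    have "(\<Sum>\<xi>\<in>S. P h \<eta> \<xi>) = P h \<eta> \<eta> + (\<Sum>\<xi>\<in>S - {\<eta>}. P h \<eta> \<xi>)"
      using assms finite_S by (simp add: sum.remove)
    with total[of h \<eta>] elim assms show ?case by simp
  qed
  ultimately show ?thesis by (rule Lim_transform_eventually)
qed

text \<open>
  By \<open>diagonal_tendsto_1\<close>, \<open>P h \<eta> \<eta>\<close> is positive for small \<open>h\<close>, and so being at \<open>\<eta>\<close> at each of the times \<open>h, 2 h, \<dots>, t\<close> has positive probability.
\<close>
lemma diagonal_pos:
  assumes "0 \<le> t" "\<eta> \<in> S"
  shows "0 < P t \<eta> \<eta>"
proof (cases "t = 0")
  case True
  with assms show ?thesis by (simp add: initial)
next
  case False
  with assms have "0 < t" by simp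
  have "\<forall>\<^sub>F h in at_right 0. 0 < P h \<eta> \<eta>"
    using order_tendstoD(1)[OF diagonal_tendsto_1[OF assms(2)]] by simp
  then have "\<forall>\<^sub>F n in sequentially. 0 < P (t / real (Suc n)) \<eta> \<eta>"
    using filterlim_divide_nat_at_right_0[OF \<open>0 < t\<close>] by (rule eventually_compose_filterlim)
  then obtain n where n: "0 < P (t / real (Suc n)) \<eta> \<eta>"
    by (auto simp: eventually_sequentially)
  define h where "h = t / real (Suc n)"
  have "0 < P (real (Suc m) * h) \<eta> \<eta>" for m
  proof (induction m)
    case 0
    then show ?case using n by (simp add: h_def)
  next
    case (Suc m)
    have "0 \<le> h" using \<open>0 < t\<close> by (simp add: h_def)
    then have "0 < P (real (Suc m) * h + h) \<eta> \<eta>"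
      using Suc n assms by (intro two_step_pos[of _ _ _ \<eta>]) (auto simp: h_def)
    then show ?case by (simp add: algebra_simps)
  qed
  from this[of n] show ?thesis by (simp add: h_def)
qed

text \<open>
  The process may wait at \<open>\<eta>\<close> until shortly before \<open>t\<close> and then jump, so positivity at some small
  time carries over to every positive time.  This excludes periodicity.
\<close>
lemma pos_if_rate_pos:
  assumes "0 < t" "\<eta> \<in> S" "\<xi> \<in> S" "0 < q \<eta> \<xi>"
  shows "0 < P t \<eta> \<xi>"
proof (cases "\<xi> = \<eta>")
  case True
  with assms diagonal_pos show ?thesis by simp
next
  case False
  have "\<forall>\<^sub>F h in at_right 0. 0 < P h \<eta> \<xi> / h"
    using order_tendstoD(1)[OF jump_rate[OF assms(2,3) False]] assms(4) by simp
  moreover have "\<forall>\<^sub>F h in at_right 0. h \<in> {0<..<t}"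
    using assms(1) by (rule eventually_at_right_real)
  ultimately have "\<forall>\<^sub>F h in at_right 0. 0 < h \<and> h < t \<and> 0 < P h \<eta> \<xi>"
    by eventually_elim (auto simp: zero_less_divide_iff)
  then obtain h where "0 < h" "h < t" "0 < P h \<eta> \<xi>"
    using eventually_happens'[OF trivial_limit_at_right_real] by blast
  then have "0 < P ((t - h) + h) \<eta> \<xi>"
    using assms by (intro two_step_pos[of _ _ _ \<eta>] diagonal_pos) auto
  then show ?thesis by simp
qed

lemma pos_if_reachable:
  assumes "(\<eta>, \<xi>) \<in> {(\<eta>, \<xi>). \<eta> \<in> S \<and> \<xi> \<in> S \<and> 0 < q \<eta> \<xi>}\<^sup>*" "\<eta> \<in> S" "0 < t"
  shows "0 < P t \<eta> \<xi>"
  using assms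
proof (induction arbitrary: t rule: rtrancl_induct)
  case base
  then show ?case by (simp add: diagonal_pos)
next
  case (step \<zeta> \<xi>)
  have "0 < P (t / 2 + t / 2) \<eta> \<xi>"
    using step by (intro two_step_pos[of _ _ _ \<zeta>] step.IH pos_if_rate_pos) auto
  then show ?case by simp
qed

text \<open>
  The defect \<open>d t = \<pi> P\<^sub>t - \<pi>\<close> satisfies \<open>d (s + t) = d s P\<^sub>t + d t\<close>.  As \<open>P\<^sub>t\<close> does not increase
  the \<open>l\<^sup>1\<close>-norm, the norm of \<open>d\<close> is subadditive.  At small times \<open>d\<close> is the net flow between
  pairs of distinct states, whose first-order part is zero by detailed balance.
\<close>
lemma stationary_if_reversible:
  assumes balance: "\<And>\<eta> \<xi>. \<eta> \<in> S \<Longrightarrow> \<xi> \<in> S \<Longrightarrow> \<pi> \<eta> * q \<eta> \<xi> = \<pi> \<xi> * q \<xi> \<eta>"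
    and "0 \<le> t" "\<xi> \<in> S"
  shows "(\<Sum>\<eta>\<in>S. \<pi> \<eta> * P t \<eta> \<xi>) = \<pi> \<xi>"
proof (cases "t = 0")
  case True
  have "(\<Sum>\<eta>\<in>S. \<pi> \<eta> * P 0 \<eta> \<xi>) = (\<Sum>\<eta>\<in>S. if \<eta> = \<xi> then \<pi> \<xi> else 0)"
    using assms by (intro sum.cong) (auto simp: initial)
  with True assms finite_S show ?thesis by simp
next
  case False
  with assms have "0 < t" by simp
  define d where "d t \<xi> = (\<Sum>\<eta>\<in>S. \<pi> \<eta> * P t \<eta> \<xi>) - \<pi> \<xi>" for t \<xi>
  define f where "f t = (\<Sum>\<xi>\<in>S. \<bar>d t \<xi>\<bar>)" for t
  have "f t = 0"
  proof (rule subadditive_eq_0[OF _ _ _ \<open>0 < t\<close>])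
    show "0 \<le> f t" for t by (auto simp: f_def intro: sum_nonneg)
  next
    fix s t :: real assume st: "0 \<le> s" "0 \<le> t"
    have split: "d (s + t) \<xi> = (\<Sum>\<zeta>\<in>S. d s \<zeta> * P t \<zeta> \<xi>) + d t \<xi>" if "\<xi> \<in> S" for \<xi>
    proof -
      have "(\<Sum>\<eta>\<in>S. \<pi> \<eta> * P (s + t) \<eta> \<xi>) = (\<Sum>\<eta>\<in>S. \<Sum>\<zeta>\<in>S. \<pi> \<eta> * P s \<eta> \<zeta> * P t \<zeta> \<xi>)"
        using st that by (intro sum.cong) (auto simp: chapman_kolmogorov sum_distrib_left mult.assoc)
      also have "\<dots> = (\<Sum>\<zeta>\<in>S. (\<Sum>\<eta>\<in>S. \<pi> \<eta> * P s \<eta> \<zeta>) * P t \<zeta> \<xi>)"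
        unfolding sum_distrib_right by (rule sum.swap)
      also have "\<dots> = (\<Sum>\<zeta>\<in>S. d s \<zeta> * P t \<zeta> \<xi> + \<pi> \<zeta> * P t \<zeta> \<xi>)"
        by (intro sum.cong) (auto simp: d_def algebra_simps)
      finally show ?thesis by (simp add: d_def[of "s + t"] d_def[of t] sum.distrib)
    qed
    have "f (s + t) \<le> (\<Sum>\<xi>\<in>S. (\<Sum>\<zeta>\<in>S. \<bar>d s \<zeta>\<bar> * P t \<zeta> \<xi>) + \<bar>d t \<xi>\<bar>)"
      unfolding f_def
    proof (rule sum_mono)
      fix \<xi> assume "\<xi> \<in> S"
      have "\<bar>\<Sum>\<zeta>\<in>S. d s \<zeta> * P t \<zeta> \<xi>\<bar> \<le> (\<Sum>\<zeta>\<in>S. \<bar>d s \<zeta> * P t \<zeta> \<xi>\<bar>)"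
        by (rule sum_abs)
      also have "\<dots> = (\<Sum>\<zeta>\<in>S. \<bar>d s \<zeta>\<bar> * P t \<zeta> \<xi>)"
        using \<open>\<xi> \<in> S\<close> st by (intro sum.cong) (auto simp: abs_mult nonneg)
      finally show "\<bar>d (s + t) \<xi>\<bar> \<le> (\<Sum>\<zeta>\<in>S. \<bar>d s \<zeta>\<bar> * P t \<zeta> \<xi>) + \<bar>d t \<xi>\<bar>"
        using split[OF \<open>\<xi> \<in> S\<close>] by linarith
    qed
    also have "\<dots> = (\<Sum>\<xi>\<in>S. \<Sum>\<zeta>\<in>S. \<bar>d s \<zeta>\<bar> * P t \<zeta> \<xi>) + f t"
      by (simp add: sum.distrib f_def)
    also have "(\<Sum>\<xi>\<in>S. \<Sum>\<zeta>\<in>S. \<bar>d s \<zeta>\<bar> * P t \<zeta> \<xi>) = (\<Sum>\<zeta>\<in>S. \<Sum>\<xi>\<in>S. \<bar>d s \<zeta>\<bar> * P t \<zeta> \<xi>)"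
      by (rule sum.swap)
    also have "\<dots> = f s"
      unfolding f_def using st by (intro sum.cong) (auto simp: total simp flip: sum_distrib_left)
    finally show "f (s + t) \<le> f s + f t" .
  next
    have flow: "((\<lambda>h. (\<Sum>\<eta>\<in>S - {\<xi>}. \<pi> \<eta> * (P h \<eta> \<xi> / h) - \<pi> \<xi> * (P h \<xi> \<eta> / h))) \<longlongrightarrow> 0) (at_right 0)"
      if "\<xi> \<in> S" for \<xi>
    proof -
      have "((\<lambda>h. (\<Sum>\<eta>\<in>S - {\<xi>}. \<pi> \<eta> * (P h \<eta> \<xi> / h) - \<pi> \<xi> * (P h \<xi> \<eta> / h)))
          \<longlongrightarrow> (\<Sum>\<eta>\<in>S - {\<xi>}. \<pi> \<eta> * q \<eta> \<xi> - \<pi> \<xi> * q \<xi> \<eta>)) (at_right 0)"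
        using that by (intro tendsto_intros jump_rate) auto
      also have "(\<Sum>\<eta>\<in>S - {\<xi>}. \<pi> \<eta> * q \<eta> \<xi> - \<pi> \<xi> * q \<xi> \<eta>) = 0"
        using that balance by (intro sum.neutral) auto
      finally show ?thesis .
    qed
    have net_flow: "d h \<xi> / h = (\<Sum>\<eta>\<in>S - {\<xi>}. \<pi> \<eta> * (P h \<eta> \<xi> / h) - \<pi> \<xi> * (P h \<xi> \<eta> / h))"
      if "0 < h" "\<xi> \<in> S" for h \<xi>
    proof -
      have "(\<Sum>\<eta>\<in>S. \<pi> \<eta> * P h \<eta> \<xi>) - \<pi> \<xi> = (\<Sum>\<eta>\<in>S. \<pi> \<eta> * P h \<eta> \<xi>) - (\<Sum>\<eta>\<in>S. \<pi> \<xi> * P h \<xi> \<eta>)"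
        using that by (simp add: total flip: sum_distrib_left)
      also have "\<dots> = (\<Sum>\<eta>\<in>S. \<pi> \<eta> * P h \<eta> \<xi> - \<pi> \<xi> * P h \<xi> \<eta>)"
        by (simp add: sum_subtractf)
      also have "\<dots> = (\<Sum>\<eta>\<in>S - {\<xi>}. \<pi> \<eta> * P h \<eta> \<xi> - \<pi> \<xi> * P h \<xi> \<eta>)"
        using that finite_S by (simp add: sum.remove)
      finally show ?thesis
        using that by (simp add: d_def sum_divide_distrib diff_divide_distrib)
    qed
    have "((\<lambda>h. \<Sum>\<xi>\<in>S. \<bar>\<Sum>\<eta>\<in>S - {\<xi>}. \<pi> \<eta> * (P h \<eta> \<xi> / h) - \<pi> \<xi> * (P h \<xi> \<eta> / h)\<bar>)
        \<longlongrightarrow> (\<Sum>\<xi>\<in>S. \<bar>0\<bar>)) (at_right 0)"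
      by (intro tendsto_sum tendsto_rabs flow)
    then have "((\<lambda>h. \<Sum>\<xi>\<in>S. \<bar>\<Sum>\<eta>\<in>S - {\<xi>}. \<pi> \<eta> * (P h \<eta> \<xi> / h) - \<pi> \<xi> * (P h \<xi> \<eta> / h)\<bar>)
        \<longlongrightarrow> 0) (at_right 0)" by simp
    then show "((\<lambda>h. f h / h) \<longlongrightarrow> 0) (at_right 0)"
    proof (rule Lim_transform_eventually)
      show "\<forall>\<^sub>F h in at_right 0. (\<Sum>\<xi>\<in>S. \<bar>\<Sum>\<eta>\<in>S - {\<xi>}. \<pi> \<eta> * (P h \<eta> \<xi> / h) - \<pi> \<xi> * (P h \<xi> \<eta> / h)\<bar>) = f h / h"
        using eventually_at_right_less[of 0]
      proof eventually_elim
        case (elim h)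
        then have "(\<Sum>\<xi>\<in>S. \<bar>\<Sum>\<eta>\<in>S - {\<xi>}. \<pi> \<eta> * (P h \<eta> \<xi> / h) - \<pi> \<xi> * (P h \<xi> \<eta> / h)\<bar>) = (\<Sum>\<xi>\<in>S. \<bar>d h \<xi> / h\<bar>)"
          by (intro sum.cong refl) (simp only: net_flow)
        with elim show ?case
          by (simp add: f_def sum_divide_distrib)
      qed
    qed
  qed
  then have "\<bar>d t \<xi>\<bar> = 0"
    using assms(3) finite_S unfolding f_def by (subst (asm) sum_nonneg_eq_0_iff) auto
  then show ?thesis by (simp add: d_def)
qed

text \<open>
  The measure \<open>\<pi>\<close> may vanish on part of \<open>S\<close>, so the theorem covers one irreducible class of a
  reducible chain.  That the support of \<open>\<pi>\<close> cannot be left follows from stationarity: mass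
  carried out of it would have to appear where \<open>\<pi>\<close> is zero.
\<close>
theorem tendsto_stationary:
  assumes pi_nonneg: "\<And>\<eta>. \<eta> \<in> S \<Longrightarrow> 0 \<le> \<pi> \<eta>"
    and pi_total: "(\<Sum>\<eta>\<in>S. \<pi> \<eta>) = 1"
    and balance: "\<And>\<eta> \<xi>. \<eta> \<in> S \<Longrightarrow> \<xi> \<in> S \<Longrightarrow> \<pi> \<eta> * q \<eta> \<xi> = \<pi> \<xi> * q \<xi> \<eta>"
    and irreducible: "\<And>\<eta> \<xi>. \<eta> \<in> S \<Longrightarrow> \<xi> \<in> S \<Longrightarrow> 0 < \<pi> \<eta> \<Longrightarrow> 0 < \<pi> \<xi> \<Longrightarrow>
      (\<eta>, \<xi>) \<in> {(\<eta>, \<xi>). \<eta> \<in> S \<and> \<xi> \<in> S \<and> 0 < q \<eta> \<xi>}\<^sup>*"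
    and "\<eta> \<in> S" "0 < \<pi> \<eta>" "\<xi> \<in> S"
  shows "((\<lambda>t. P t \<eta> \<xi>) \<longlongrightarrow> \<pi> \<xi>) at_top"
proof -
  note stationary = stationary_if_reversible[where \<pi> = \<pi>, OF balance]
  define A where "A = {\<eta> \<in> S. 0 < \<pi> \<eta>}"
  have A: "A \<subseteq> S" "finite A" "\<eta> \<in> A"
    using finite_S assms by (auto simp: A_def)
  have closed: "P t \<eta> \<zeta> = 0" if "0 \<le> t" "\<eta> \<in> A" "\<zeta> \<in> S - A" for t \<eta> \<zeta>
  proof -
    have "\<pi> \<zeta> = 0"
      using that pi_nonneg[of \<zeta>] by (auto simp: A_def)
    then have "(\<Sum>\<eta>\<in>S. \<pi> \<eta> * P t \<eta> \<zeta>) = 0"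
      using stationary[of t \<zeta>] that by simp
    then have "\<pi> \<eta> * P t \<eta> \<zeta> = 0"
      using that A finite_S
      by (subst (asm) sum_nonneg_eq_0_iff) (auto intro!: mult_nonneg_nonneg pi_nonneg nonneg)
    with that show ?thesis by (simp add: A_def)
  qed
  have pi_le_1: "\<pi> \<zeta> \<le> 1" if "\<zeta> \<in> S" for \<zeta>
    using member_le_sum[of \<zeta> S \<pi>] that pi_nonneg finite_S pi_total by auto
  \<comment> \<open>Since \<open>\<pi> \<le> 1\<close>, the least entry of \<open>P\<^sub>1\<close> on the support serves as Doeblin constant.\<close>
  define \<delta> where "\<delta> = Min ((\<lambda>(\<eta>, \<zeta>). P 1 \<eta> \<zeta>) ` (A \<times> A))"
  have \<delta>_le: "\<delta> \<le> P 1 \<eta> \<zeta>" if "\<eta> \<in> A" "\<zeta> \<in> A" for \<eta> \<zeta>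
    unfolding \<delta>_def using A that by (intro Min_le) auto
  have "0 < P 1 \<eta> \<zeta>" if "\<eta> \<in> A" "\<zeta> \<in> A" for \<eta> \<zeta>
    using that irreducible[of \<eta> \<zeta>] by (intro pos_if_reachable) (auto simp: A_def)
  then have "0 < \<delta>"
    unfolding \<delta>_def using A by (subst Min_gr_iff) auto
  have "\<delta> \<le> 1"
    using \<delta>_le[OF A(3) A(3)] le_1[of 1 \<eta> \<eta>] assms by simp
  have minorization: "\<delta> * \<pi> \<zeta> \<le> P 1 \<eta> \<zeta>" if "\<eta> \<in> A" "\<zeta> \<in> S" for \<eta> \<zeta>
  proof (cases "\<zeta> \<in> A")
    case True
    have "\<delta> * \<pi> \<zeta> \<le> \<delta> * 1"
      using \<open>0 < \<delta>\<close> pi_le_1[OF that(2)] by (intro mult_left_mono) auto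
    with \<delta>_le[OF that(1) True] show ?thesis by simp
  next
    case False
    with that pi_nonneg[of \<zeta>] have "\<pi> \<zeta> = 0" by (auto simp: A_def)
    with that A show ?thesis by (auto intro: nonneg)
  qed
  have decay: "\<bar>P t \<eta> \<xi> - \<pi> \<xi>\<bar> \<le> (1 - \<delta>) ^ n" if "real n \<le> t" "\<eta> \<in> A" for n t \<eta>
    using that
  proof (induction n arbitrary: t \<eta>)
    case 0
    then have "0 \<le> P t \<eta> \<xi>" "P t \<eta> \<xi> \<le> 1"
      using A assms by (auto intro: nonneg le_1)
    moreover have "0 \<le> \<pi> \<xi>" "\<pi> \<xi> \<le> 1"
      using assms by (auto intro: pi_nonneg pi_le_1)
    ultimately show ?case unfolding power_0 by linarith
  next
    case (Suc n)
    define s where "s = t - 1"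
    have s: "t = 1 + s" "real n \<le> s" "0 \<le> s"
      using Suc.prems by (auto simp: s_def)
    have "\<eta> \<in> S" using Suc.prems A by auto
    \<comment> \<open>The part \<open>\<delta> \<pi>\<close> of row \<open>\<eta>\<close> of \<open>P\<^sub>1\<close> contributes nothing to the deviation from
      equilibrium; only the remaining row, of mass \<open>1 - \<delta>\<close>, does.\<close>
    have "(\<Sum>\<zeta>\<in>S. P 1 \<eta> \<zeta> * (P s \<zeta> \<xi> - \<pi> \<xi>)) = P t \<eta> \<xi> - (\<Sum>\<zeta>\<in>S. P 1 \<eta> \<zeta>) * \<pi> \<xi>"
      using s \<open>\<eta> \<in> S\<close> assms
      by (simp add: right_diff_distrib sum_subtractf chapman_kolmogorov sum_distrib_right)
    moreover have "(\<Sum>\<zeta>\<in>S. \<pi> \<zeta> * (P s \<zeta> \<xi> - \<pi> \<xi>)) = 0"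
      using stationary[of s \<xi>] s assms
      by (simp add: right_diff_distrib sum_subtractf pi_total flip: sum_distrib_right)
    ultimately have "P t \<eta> \<xi> - \<pi> \<xi> =
        (\<Sum>\<zeta>\<in>S. P 1 \<eta> \<zeta> * (P s \<zeta> \<xi> - \<pi> \<xi>)) - \<delta> * (\<Sum>\<zeta>\<in>S. \<pi> \<zeta> * (P s \<zeta> \<xi> - \<pi> \<xi>))"
      using \<open>\<eta> \<in> S\<close> by (simp add: total)
    also have "\<dots> = (\<Sum>\<zeta>\<in>S. (P 1 \<eta> \<zeta> - \<delta> * \<pi> \<zeta>) * (P s \<zeta> \<xi> - \<pi> \<xi>))"
      by (simp add: sum_distrib_left algebra_simps sum_subtractf sum.distrib)
    also have "\<bar>\<dots>\<bar> \<le> (\<Sum>\<zeta>\<in>S. \<bar>(P 1 \<eta> \<zeta> - \<delta> * \<pi> \<zeta>) * (P s \<zeta> \<xi> - \<pi> \<xi>)\<bar>)"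
      by (rule sum_abs)
    also have "\<dots> \<le> (\<Sum>\<zeta>\<in>S. (P 1 \<eta> \<zeta> - \<delta> * \<pi> \<zeta>) * (1 - \<delta>) ^ n)"
    proof (rule sum_mono)
      fix \<zeta> assume "\<zeta> \<in> S"
      show "\<bar>(P 1 \<eta> \<zeta> - \<delta> * \<pi> \<zeta>) * (P s \<zeta> \<xi> - \<pi> \<xi>)\<bar> \<le> (P 1 \<eta> \<zeta> - \<delta> * \<pi> \<zeta>) * (1 - \<delta>) ^ n"
      proof (cases "\<zeta> \<in> A")
        case True
        then show ?thesis
          using minorization[OF Suc.prems(2) \<open>\<zeta> \<in> S\<close>] Suc.IH[OF s(2)]
          by (auto simp: abs_mult intro: mult_left_mono)
      next
        case False
        with \<open>\<zeta> \<in> S\<close> pi_nonneg[of \<zeta>] have "\<pi> \<zeta> = 0" by (auto simp: A_def)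
        with closed[of 1 \<eta> \<zeta>] False \<open>\<zeta> \<in> S\<close> Suc.prems show ?thesis by simp
      qed
    qed
    also have "\<dots> = (1 - \<delta>) ^ Suc n"
      using \<open>\<eta> \<in> S\<close>
      by (simp add: sum_subtractf total pi_total flip: sum_distrib_right sum_distrib_left)
    finally show ?case .
  qed
  have floor_top: "filterlim (\<lambda>t::real. nat \<lfloor>t\<rfloor>) sequentially at_top"
    by (intro filterlim_compose[OF filterlim_nat_sequentially] filterlim_floor_sequentially)
  have "(\<lambda>n. (1 - \<delta>) ^ n) \<longlonglongrightarrow> 0"
    using \<open>0 < \<delta>\<close> \<open>\<delta> \<le> 1\<close> by (intro LIMSEQ_power_zero) auto
  from filterlim_compose[OF this floor_top]
  have "((\<lambda>t::real. (1 - \<delta>) ^ nat \<lfloor>t\<rfloor>) \<longlongrightarrow> 0) at_top" .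
  then have "((\<lambda>t. P t \<eta> \<xi> - \<pi> \<xi>) \<longlongrightarrow> 0) at_top"
  proof (rule Lim_null_comparison[rotated])
    show "\<forall>\<^sub>F t in at_top. norm (P t \<eta> \<xi> - \<pi> \<xi>) \<le> (1 - \<delta>) ^ nat \<lfloor>t\<rfloor>"
      using eventually_ge_at_top[of 0]
    proof eventually_elim
      case (elim t)
      then have "real (nat \<lfloor>t\<rfloor>) \<le> t" by simp
      from decay[OF this A(3)] show ?case by simp
    qed
  qed
  then show ?thesis by (simp add: Lim_null[symmetric])
qed

end

section \<open>Conditional laws of a Markov chain\<close>

lemma (in markov_chain) obtain_transition_function:
  obtains P where "finite_transition_function S P q"
    and "\<And>t \<eta> \<xi>. 0 < t \<Longrightarrow> \<eta> \<in> S \<Longrightarrow> \<xi> \<in> S \<Longrightarrow> \<P>(\<omega> in M. X 0 \<omega> = \<eta>) > 0 \<Longrightarrow>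
      \<P>(\<omega> in M. X t \<omega> = \<xi> \<bar> X 0 \<omega> = \<eta>) = P t \<eta> \<xi>"
proof -
  obtain P where P: "transition_function S P" "has_jump_rates S P q"
    and markov: "\<And>(n::nat) (t :: nat \<Rightarrow> real) (\<eta> :: nat \<Rightarrow> 's).
        0 \<le> t 0 \<Longrightarrow> (\<forall>i\<le>n. t i < t (Suc i)) \<Longrightarrow> (\<forall>i\<le>Suc n. \<eta> i \<in> S) \<Longrightarrow>
        \<P>(\<omega> in M. \<forall>i\<le>n. X (t i) \<omega> = \<eta> i) > 0 \<Longrightarrow>
        \<P>(\<omega> in M. X (t (Suc n)) \<omega> = \<eta> (Suc n) \<bar> \<forall>i\<le>n. X (t i) \<omega> = \<eta> i)
          = P (t (Suc n) - t n) (\<eta> n) (\<eta> (Suc n))"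
    using markov_property by blast
  have "finite_transition_function S P q"
    using finite_states P by unfold_locales
  moreover have "\<P>(\<omega> in M. X t \<omega> = \<xi> \<bar> X 0 \<omega> = \<eta>) = P t \<eta> \<xi>"
    if "0 < t" "\<eta> \<in> S" "\<xi> \<in> S" "\<P>(\<omega> in M. X 0 \<omega> = \<eta>) > 0" for t \<eta> \<xi>
    using markov[of "\<lambda>i. real i * t" 0 "\<lambda>i. if i = 0 then \<eta> else \<xi>"] that by simp
  ultimately show thesis by (rule that)
qed

lemma (in markov_chain) state_in_events:
  assumes "0 \<le> t"
  shows "{\<omega> \<in> space M. Q (X t \<omega>)} \<in> events"
proof -
  have "X t -` {\<xi> \<in> S. Q \<xi>} \<inter> space M \<in> events"
    by (rule measurable_sets[OF measurable_states[OF assms]]) auto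
  also have "X t -` {\<xi> \<in> S. Q \<xi>} \<inter> space M = {\<omega> \<in> space M. Q (X t \<omega>)}"
    using measurable_space[OF measurable_states[OF assms]] by auto
  finally show ?thesis .
qed

lemma (in markov_chain) prob_split_state:
  assumes "0 \<le> t" "{\<omega> \<in> space M. R \<omega>} \<in> events"
  shows "\<P>(\<omega> in M. Q (X t \<omega>) \<and> R \<omega>) = (\<Sum>\<xi>\<in>{\<xi>\<in>S. Q \<xi>}. \<P>(\<omega> in M. X t \<omega> = \<xi> \<and> R \<omega>))"
proof (rule prob_sum)
  show "{\<omega> \<in> space M. X t \<omega> = \<xi> \<and> R \<omega>} \<in> events" for \<xi>
    using sets.sets_Collect_conj[OF assms(2) state_in_events[OF assms(1), of "\<lambda>\<zeta>. \<zeta> = \<xi>"]] .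
  show "{\<omega> \<in> space M. Q (X t \<omega>) \<and> R \<omega>} \<in> events"
    using sets.sets_Collect_conj[OF assms(2) state_in_events[OF assms(1), of Q]] .
  show "AE \<omega> in M. (\<forall>\<xi>\<in>{\<xi>\<in>S. Q \<xi>}. X t \<omega> = \<xi> \<and> R \<omega> \<longrightarrow> Q (X t \<omega>) \<and> R \<omega>) \<and>
      (Q (X t \<omega>) \<and> R \<omega> \<longrightarrow> (\<exists>!\<xi>. \<xi> \<in> {\<xi>\<in>S. Q \<xi>} \<and> X t \<omega> = \<xi> \<and> R \<omega>))"
  proof (rule AE_I2)
    fix \<omega> assume "\<omega> \<in> space M"
    then have "X t \<omega> \<in> S"
      using measurable_space[OF measurable_states[OF assms(1)]] by auto
    then show "(\<forall>\<xi>\<in>{\<xi>\<in>S. Q \<xi>}. X t \<omega> = \<xi> \<and> R \<omega> \<longrightarrow> Q (X t \<omega>) \<and> R \<omega>) \<and>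
      (Q (X t \<omega>) \<and> R \<omega> \<longrightarrow> (\<exists>!\<xi>. \<xi> \<in> {\<xi>\<in>S. Q \<xi>} \<and> X t \<omega> = \<xi> \<and> R \<omega>))"
      by auto
  qed
qed (use finite_states in auto)

text \<open>
  The conditional probability given \<open>I (X 0)\<close> is an average, with weights independent of \<open>t\<close>, of
  the conditional probabilities given the single initial states; a common limit survives averaging.
\<close>
lemma (in markov_chain) cond_prob_tendsto_of_initial_states:
  assumes limit: "\<And>\<eta>. \<eta> \<in> S \<Longrightarrow> I \<eta> \<Longrightarrow> \<P>(\<omega> in M. X 0 \<omega> = \<eta>) > 0 \<Longrightarrow>
      ((\<lambda>t. \<P>(\<omega> in M. Q (X t \<omega>) \<bar> X 0 \<omega> = \<eta>)) \<longlongrightarrow> l) at_top"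
    and pos: "\<P>(\<omega> in M. I (X 0 \<omega>)) > 0"
  shows "((\<lambda>t. \<P>(\<omega> in M. Q (X t \<omega>) \<bar> I (X 0 \<omega>))) \<longlongrightarrow> l) at_top"
proof -
  define w where "w \<eta> = \<P>(\<omega> in M. X 0 \<omega> = \<eta>)" for \<eta>
  define A where "A = {\<eta> \<in> S. I \<eta>}"
  have total: "\<P>(\<omega> in M. I (X 0 \<omega>)) = (\<Sum>\<eta>\<in>A. w \<eta>)"
    using prob_split_state[of 0 "\<lambda>_. True" I] by (simp add: A_def w_def)
  have "((\<lambda>t. (\<Sum>\<eta>\<in>A. w \<eta> * \<P>(\<omega> in M. Q (X t \<omega>) \<bar> X 0 \<omega> = \<eta>)) / (\<Sum>\<eta>\<in>A. w \<eta>))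
      \<longlongrightarrow> (\<Sum>\<eta>\<in>A. w \<eta> * l) / (\<Sum>\<eta>\<in>A. w \<eta>)) at_top"
  proof (intro tendsto_divide tendsto_sum tendsto_const)
    fix \<eta> assume "\<eta> \<in> A"
    show "((\<lambda>t. w \<eta> * \<P>(\<omega> in M. Q (X t \<omega>) \<bar> X 0 \<omega> = \<eta>)) \<longlongrightarrow> w \<eta> * l) at_top"
    proof (cases "w \<eta> = 0")
      case False
      then have "\<P>(\<omega> in M. X 0 \<omega> = \<eta>) > 0"
        by (simp add: w_def zero_less_measure_iff)
      with \<open>\<eta> \<in> A\<close> show ?thesis
        by (intro tendsto_mult tendsto_const limit) (auto simp: A_def)
    qed simp
  qed (use pos total in simp)
  also have "(\<Sum>\<eta>\<in>A. w \<eta> * l) / (\<Sum>\<eta>\<in>A. w \<eta>) = l"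
    using pos total by (simp flip: sum_distrib_right)
  finally show ?thesis
  proof (rule Lim_transform_eventually)
    show "\<forall>\<^sub>F t in at_top. (\<Sum>\<eta>\<in>A. w \<eta> * \<P>(\<omega> in M. Q (X t \<omega>) \<bar> X 0 \<omega> = \<eta>)) / (\<Sum>\<eta>\<in>A. w \<eta>)
        = \<P>(\<omega> in M. Q (X t \<omega>) \<bar> I (X 0 \<omega>))"
      using eventually_ge_at_top[of 0]
    proof eventually_elim
      case (elim t)
      have "w \<eta> * \<P>(\<omega> in M. Q (X t \<omega>) \<bar> X 0 \<omega> = \<eta>) = \<P>(\<omega> in M. X 0 \<omega> = \<eta> \<and> Q (X t \<omega>))" for \<eta>
      proof (cases "w \<eta> = 0")
        case True
        have "\<P>(\<omega> in M. X 0 \<omega> = \<eta> \<and> Q (X t \<omega>)) \<le> w \<eta>"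
          unfolding w_def by (intro finite_measure_mono state_in_events) auto
        with True show ?thesis by (simp add: measure_le_0_iff)
      next
        case False
        then show ?thesis by (simp add: cond_prob_def w_def conj_commute)
      qed
      then have "(\<Sum>\<eta>\<in>A. w \<eta> * \<P>(\<omega> in M. Q (X t \<omega>) \<bar> X 0 \<omega> = \<eta>)) = \<P>(\<omega> in M. I (X 0 \<omega>) \<and> Q (X t \<omega>))"
        using prob_split_state[of 0 "\<lambda>\<omega>. Q (X t \<omega>)" I] state_in_events[OF elim]
        by (simp add: A_def)
      also have "{\<omega> \<in> space M. I (X 0 \<omega>) \<and> Q (X t \<omega>)} = {\<omega> \<in> space M. Q (X t \<omega>) \<and> I (X 0 \<omega>)}"
        by blast
      finally show ?case
        by (simp only: cond_prob_def[of M "\<lambda>\<omega>. Q (X t \<omega>)" "\<lambda>\<omega>. I (X 0 \<omega>)"] total)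
    qed
  qed
qed

theorem (in markov_chain) cond_prob_tendsto_stationary:
  assumes pi_nonneg: "\<And>\<eta>. \<eta> \<in> S \<Longrightarrow> 0 \<le> \<pi> \<eta>"
    and pi_total: "(\<Sum>\<eta>\<in>S. \<pi> \<eta>) = 1"
    and balance: "\<And>\<eta> \<xi>. \<eta> \<in> S \<Longrightarrow> \<xi> \<in> S \<Longrightarrow> \<pi> \<eta> * q \<eta> \<xi> = \<pi> \<xi> * q \<xi> \<eta>"
    and irreducible: "\<And>\<eta> \<xi>. \<eta> \<in> S \<Longrightarrow> \<xi> \<in> S \<Longrightarrow> 0 < \<pi> \<eta> \<Longrightarrow> 0 < \<pi> \<xi> \<Longrightarrow>
      (\<eta>, \<xi>) \<in> {(\<eta>, \<xi>). \<eta> \<in> S \<and> \<xi> \<in> S \<and> 0 < q \<eta> \<xi>}\<^sup>*"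
    and "\<eta> \<in> S" "0 < \<pi> \<eta>" and start: "\<P>(\<omega> in M. X 0 \<omega> = \<eta>) > 0"
  shows "((\<lambda>t. \<P>(\<omega> in M. Q (X t \<omega>) \<bar> X 0 \<omega> = \<eta>)) \<longlongrightarrow> (\<Sum>\<xi>\<in>{\<xi>\<in>S. Q \<xi>}. \<pi> \<xi>)) at_top"
proof -
  obtain P where P: "finite_transition_function S P q"
    and law: "\<And>t \<eta> \<xi>. 0 < t \<Longrightarrow> \<eta> \<in> S \<Longrightarrow> \<xi> \<in> S \<Longrightarrow> \<P>(\<omega> in M. X 0 \<omega> = \<eta>) > 0 \<Longrightarrow>
      \<P>(\<omega> in M. X t \<omega> = \<xi> \<bar> X 0 \<omega> = \<eta>) = P t \<eta> \<xi>"
    using obtain_transition_function by blast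
  have "((\<lambda>t. \<Sum>\<xi>\<in>{\<xi>\<in>S. Q \<xi>}. P t \<eta> \<xi>) \<longlongrightarrow> (\<Sum>\<xi>\<in>{\<xi>\<in>S. Q \<xi>}. \<pi> \<xi>)) at_top"
    using assms
    by (intro tendsto_sum finite_transition_function.tendsto_stationary[OF P]) auto
  then show ?thesis
  proof (rule Lim_transform_eventually)
    show "\<forall>\<^sub>F t in at_top. (\<Sum>\<xi>\<in>{\<xi>\<in>S. Q \<xi>}. P t \<eta> \<xi>) = \<P>(\<omega> in M. Q (X t \<omega>) \<bar> X 0 \<omega> = \<eta>)"
      using eventually_gt_at_top[of 0]
    proof eventually_elim
      case (elim t)
      have "\<P>(\<omega> in M. Q (X t \<omega>) \<bar> X 0 \<omega> = \<eta>) = (\<Sum>\<xi>\<in>{\<xi>\<in>S. Q \<xi>}. \<P>(\<omega> in M. X t \<omega> = \<xi> \<bar> X 0 \<omega> = \<eta>))"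
        using prob_split_state[of t "\<lambda>\<omega>. X 0 \<omega> = \<eta>" Q] state_in_events[of 0 "\<lambda>\<zeta>. \<zeta> = \<eta>"] elim
        by (simp add: cond_prob_def sum_divide_distrib)
      also have "\<dots> = (\<Sum>\<xi>\<in>{\<xi>\<in>S. Q \<xi>}. P t \<eta> \<xi>)"
        using elim law start \<open>\<eta> \<in> S\<close> by (intro sum.cong) auto
      finally show ?case by simp
    qed
  qed
qed

section \<open>Particles move freely on a connected graph\<close>

locale weighted_connected_graph = pair_graph G
  for G :: "'v pair_pre_digraph" +
  fixes \<rho> :: "'v \<Rightarrow> real"
  assumes connected: "Digraph_Component.connected (with_proj G)"
    and two_vertices: "2 \<le> card (pverts G)"
    and rate_pos: "x \<in> pverts G \<Longrightarrow> 0 < \<rho> x"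
begin

lemma arc_sym: "(x, y) \<in> parcs G \<Longrightarrow> (y, x) \<in> parcs G"
  using pair_sym_arcs by (auto simp: symmetric_def elim: symE)

lemma connected_by_arcs:
  assumes "x \<in> pverts G" "y \<in> pverts G"
  shows "(x, y) \<in> (parcs G)\<^sup>*"
proof -
  have "parcs (mk_symmetric (with_proj G)) = parcs G"
    using arc_sym by (auto simp: parcs_mk_symmetric)
  moreover have "(x, y) \<in> rtrancl_on (pverts G) (parcs (mk_symmetric (with_proj G)))"
    using connected assms
    by (auto simp: Digraph_Component.connected_def strongly_connected_def reachable_def)
  ultimately show ?thesis
    by (metis rtrancl_on_rtranclI)
qed

lemma deg_pos:
  assumes "x \<in> pverts G"
  shows "0 < deg G x"
proof -
  have "\<not> pverts G \<subseteq> {x}"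
    using two_vertices card_mono[of "{x}" "pverts G"] by auto
  then obtain y where "y \<in> pverts G" "y \<noteq> x" by blast
  with connected_by_arcs[OF assms] obtain z where "(x, z) \<in> parcs G"
    by (metis converse_rtranclE)
  then have "(x, z) \<in> out_arcs (with_proj G) x" by (simp add: out_arcs_def)
  moreover have "finite (out_arcs (with_proj G) x)"
    using pair_finite_arcs by (simp add: out_arcs_def)
  ultimately show ?thesis
    unfolding out_degree_def card_gt_0_iff by blast
qed

lemma site_weight_pos: "x \<in> pverts G \<Longrightarrow> 0 < site_weight G \<rho> x"
  by (simp add: site_weight_def deg_pos rate_pos)

lemma config_weight_pos: "\<eta> \<subseteq> pverts G \<Longrightarrow> 0 < config_weight G \<rho> \<eta>"
  unfolding config_weight_def by (intro prod_pos) (auto intro: site_weight_pos)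

lemma exchange_eq_move:
  "x \<in> \<eta> \<Longrightarrow> y \<notin> \<eta> \<Longrightarrow> exchange x y \<eta> = insert y (\<eta> - {x})"
  by (auto simp: mem_exchange_iff Transposition.transpose_def split: if_splits)

lemma exclusion_rate_move:
  assumes "(x, y) \<in> parcs G" "x \<in> \<eta>" "y \<notin> \<eta>"
  shows "exclusion_rate G \<rho> \<eta> (insert y (\<eta> - {x})) = \<rho> x / deg G x"
proof -
  have "exchange x y \<eta> \<noteq> \<eta>"
    using assms by (auto simp: exchange_eq_move)
  from exclusion_rate_edge[OF assms(1,2) this] show ?thesis
    by (simp add: exchange_eq_move assms)
qed

text \<open>
  The jumps are kept inside the powerset of the vertices so that this relation is the one of which
  \<open>tendsto_stationary\<close> takes the closure.
\<close>
definition possible_jumps :: "('v set \<times> 'v set) set" where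
  "possible_jumps = {(\<eta>, \<xi>). \<eta> \<in> Pow (pverts G) \<and> \<xi> \<in> Pow (pverts G) \<and> 0 < exclusion_rate G \<rho> \<eta> \<xi>}"

lemma move_in_possible_jumps:
  assumes "(x, y) \<in> parcs G" "x \<in> \<eta>" "y \<notin> \<eta>" "\<eta> \<subseteq> pverts G"
  shows "(\<eta>, insert y (\<eta> - {x})) \<in> possible_jumps"
proof -
  have "x \<in> pverts G" "y \<in> pverts G"
    using assms(1) wellformed' by auto
  then show ?thesis
    using assms by (auto simp: possible_jumps_def exclusion_rate_move deg_pos rate_pos)
qed

text \<open>
  Only the resulting configuration matters, not which particle ends up where.  If the next vertex
  \<open>z\<close> on the path to \<open>y\<close> is empty, the particle at \<open>x\<close> steps there and continues.  If \<open>z\<close> is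
  occupied, its particle is sent to \<open>y\<close> first, and the particle at \<open>x\<close> then takes its place.
\<close>
lemma transport_particle:
  assumes "(x, y) \<in> (parcs G)\<^sup>*" "x \<in> \<eta>" "y \<notin> \<eta>" "\<eta> \<subseteq> pverts G"
  shows "(\<eta>, insert y (\<eta> - {x})) \<in> possible_jumps\<^sup>*"
  using assms
proof (induction arbitrary: \<eta> rule: converse_rtrancl_induct)
  case (step x z)
  have "x \<noteq> z" using step.hyps no_loops' by blast
  have "z \<in> pverts G" using step.hyps wellformed' by auto
  show ?case
  proof (cases "z \<in> \<eta>")
    case True
    define \<eta>' where "\<eta>' = insert y (\<eta> - {z})"
    have "y \<in> pverts G"
      using step.hyps(2) \<open>z \<in> pverts G\<close> by (induction rule: rtrancl_induct) (auto dest: wellformed')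
    have "(\<eta>, \<eta>') \<in> possible_jumps\<^sup>*"
      unfolding \<eta>'_def using True step.prems by (intro step.IH) auto
    moreover have "(\<eta>', insert z (\<eta>' - {x})) \<in> possible_jumps"
      using step True \<open>x \<noteq> z\<close> \<open>y \<in> pverts G\<close>
      by (intro move_in_possible_jumps) (auto simp: \<eta>'_def)
    moreover have "insert z (\<eta>' - {x}) = insert y (\<eta> - {x})"
      using step.prems True \<open>x \<noteq> z\<close> by (auto simp: \<eta>'_def)
    ultimately show ?thesis by simp
  next
    case False
    then have jump: "(\<eta>, insert z (\<eta> - {x})) \<in> possible_jumps"
      using step by (intro move_in_possible_jumps) auto
    show ?thesis
    proof (cases "z = y")
      case True
      with jump show ?thesis by auto
    next
      case ne: False
      have "(insert z (\<eta> - {x}), insert y (insert z (\<eta> - {x}) - {z})) \<in> possible_jumps\<^sup>*"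
        using step.prems ne \<open>z \<in> pverts G\<close> by (intro step.IH) auto
      moreover have "insert z (\<eta> - {x}) - {z} = \<eta> - {x}"
        using False by auto
      ultimately show ?thesis
        using jump by (simp add: converse_rtrancl_into_rtrancl)
    qed
  qed
qed simp

text \<open>
  Each transport of a particle from a vertex of \<open>\<eta> - \<xi>\<close> to one of \<open>\<xi> - \<eta>\<close> reduces the number of
  misplaced particles by one.
\<close>
lemma configs_communicate:
  assumes "\<eta> \<in> configs G K" "\<xi> \<in> configs G K"
  shows "(\<eta>, \<xi>) \<in> possible_jumps\<^sup>*"
  using assms
proof (induction "card (\<eta> - \<xi>)" arbitrary: \<eta>)
  case 0
  have fin: "finite \<eta>" "finite \<xi>"
    using 0 pair_finite_verts by (auto simp: configs_def intro: finite_subset)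
  with 0 have "\<eta> \<subseteq> \<xi>" by auto
  then have "\<eta> = \<xi>"
    using 0 fin by (intro card_subset_eq) (auto simp: configs_def)
  then show ?case by simp
next
  case (Suc n)
  have fin: "finite \<eta>" "finite \<xi>"
    using Suc pair_finite_verts by (auto simp: configs_def intro: finite_subset)
  obtain x where x: "x \<in> \<eta>" "x \<notin> \<xi>"
    using Suc.hyps(2) by (metis DiffE card.empty ex_in_conv nat.distinct(1))
  have "\<not> \<xi> \<subseteq> \<eta>"
    using Suc.prems fin x card_subset_eq[of \<eta> \<xi>] by (auto simp: configs_def)
  then obtain y where y: "y \<in> \<xi>" "y \<notin> \<eta>" by blast
  define \<eta>' where "\<eta>' = insert y (\<eta> - {x})"
  have "(\<eta>, \<eta>') \<in> possible_jumps\<^sup>*"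
    unfolding \<eta>'_def using Suc.prems x y
    by (intro transport_particle connected_by_arcs) (auto simp: configs_def)
  moreover have "\<eta>' \<in> configs G K"
    using Suc.prems x y fin card_Suc_Diff1[of \<eta> x] by (auto simp: configs_def \<eta>'_def)
  moreover have "\<eta>' - \<xi> = (\<eta> - \<xi>) - {x}"
    using x y by (auto simp: \<eta>'_def)
  then have "n = card (\<eta>' - \<xi>)"
    using Suc.hyps(2) x fin by simp
  ultimately show ?case
    using Suc.hyps(1)[of \<eta>'] Suc.prems by (meson rtrancl_trans)
qed

section \<open>The equilibrium with a fixed number of particles\<close>

text \<open>
  As \<open>\<rho>\<^sub>x / deg(x)\<close> is the reciprocal of the site weight at \<open>x\<close>, multiplying by the jump rate
  removes the factor of the moving particle from the configuration weight.  What remains is the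
  weight of \<open>\<eta> - {x} = \<xi> - {y}\<close>, on both sides.
\<close>
lemma detailed_balance_move:
  assumes "(x, y) \<in> parcs G" "x \<in> \<eta>" "y \<notin> \<eta>" "\<eta> \<subseteq> pverts G" "\<xi> = insert y (\<eta> - {x})"
  shows "config_weight G \<rho> \<eta> * exclusion_rate G \<rho> \<eta> \<xi> = config_weight G \<rho> \<xi> * exclusion_rate G \<rho> \<xi> \<eta>"
proof -
  have xy: "x \<in> pverts G" "y \<in> pverts G" "x \<noteq> y"
    using assms wellformed' by auto
  have forward: "exclusion_rate G \<rho> \<eta> \<xi> = \<rho> x / deg G x"
    unfolding assms(5) using assms(1-3) by (rule exclusion_rate_move)
  have backward: "exclusion_rate G \<rho> \<xi> \<eta> = \<rho> y / deg G y"
  proof -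
    have "y \<in> \<xi>" "x \<notin> \<xi>"
      using assms(5) xy(3) by auto
    from exclusion_rate_move[OF arc_sym[OF assms(1)] this]
    have "exclusion_rate G \<rho> \<xi> (insert x (\<xi> - {y})) = \<rho> y / deg G y" .
    also have "insert x (\<xi> - {y}) = \<eta>"
      using assms(2,3,5) xy(3) by auto
    finally show ?thesis .
  qed
  have "finite \<eta>"
    using assms(4) pair_finite_verts by (rule finite_subset)
  then have weights: "config_weight G \<rho> \<eta> = site_weight G \<rho> x * config_weight G \<rho> (\<eta> - {x})"
    "config_weight G \<rho> \<xi> = site_weight G \<rho> y * config_weight G \<rho> (\<eta> - {x})"
    unfolding config_weight_def assms(5) using assms(2,3) by (simp_all add: prod.remove)
  show ?thesis
    unfolding weights forward backward using deg_pos[OF xy(1)] deg_pos[OF xy(2)] rate_pos[OF xy(1)] rate_pos[OF xy(2)]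
    by (simp add: site_weight_def)
qed

lemma detailed_balance:
  assumes "\<eta> \<subseteq> pverts G" "\<xi> \<subseteq> pverts G"
  shows "config_weight G \<rho> \<eta> * exclusion_rate G \<rho> \<eta> \<xi> = config_weight G \<rho> \<xi> * exclusion_rate G \<rho> \<xi> \<eta>"
proof -
  have exchange_moves: "y \<notin> \<eta>" "\<xi> = insert y (\<eta> - {x})"
    if "\<eta> \<noteq> \<xi>" "x \<in> \<eta>" "\<xi> = exchange x y \<eta>" for x y and \<eta> \<xi> :: "'v set"
  proof -
    show "y \<notin> \<eta>"
    proof
      assume "y \<in> \<eta>"
      then have "exchange x y \<eta> = \<eta>"
        using that(2) by (auto simp: mem_exchange_iff Transposition.transpose_def split: if_splits)
      with that show False by simp
    qed
    with that exchange_eq_move show "\<xi> = insert y (\<eta> - {x})" by simp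
  qed
  consider "\<eta> = \<xi>"
    | x y where "\<eta> \<noteq> \<xi>" "(x, y) \<in> parcs G" "x \<in> \<eta>" "\<xi> = exchange x y \<eta>"
    | x y where "\<eta> \<noteq> \<xi>" "(x, y) \<in> parcs G" "x \<in> \<xi>" "\<eta> = exchange x y \<xi>"
    | "\<not> (\<exists>x y. (x, y) \<in> parcs G \<and> x \<in> \<eta> \<and> \<xi> = exchange x y \<eta>)"
      "\<not> (\<exists>x y. (x, y) \<in> parcs G \<and> x \<in> \<xi> \<and> \<eta> = exchange x y \<xi>)"
    by blast
  then show ?thesis
  proof cases
    case (2 x y)
    note move = exchange_moves[OF 2(1,3,4)]
    show ?thesis
      by (rule detailed_balance_move[OF 2(2,3) move(1) assms(1) move(2)])
  next
    case (3 x y)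
    note move = exchange_moves[OF 3(1)[symmetric] 3(3,4)]
    show ?thesis
      by (rule detailed_balance_move[OF 3(2,3) move(1) assms(2) move(2), symmetric])
  next
    case 4
    then show ?thesis by (simp add: exclusion_rate_eq_0)
  qed simp
qed

lemma exclusion_rate_conserves_card:
  assumes "\<eta> \<subseteq> pverts G" "exclusion_rate G \<rho> \<eta> \<xi> \<noteq> 0"
  shows "\<eta> \<in> configs G K \<longleftrightarrow> \<xi> \<in> configs G K"
proof -
  obtain x y where xy: "(x, y) \<in> parcs G" "\<xi> = exchange x y \<eta>"
    using assms(2) exclusion_rate_eq_0[of G \<eta> \<xi> \<rho>] by blast
  have "Transposition.transpose x y ` pverts G = pverts G"
    using wellformed'[OF xy(1)] by (intro transpose_image_eq) simp
  then have "\<xi> \<subseteq> pverts G"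
    using assms(1) xy(2) by (auto simp: exchange_def)
  moreover have "card \<xi> = card \<eta>"
    unfolding xy(2) exchange_def by (simp add: card_image)
  ultimately show ?thesis
    using assms(1) by (simp add: configs_def)
qed

lemma finite_configs: "finite (configs G K)"
  using pair_finite_verts by (auto simp: configs_def intro: finite_subset[of _ "Pow (pverts G)"])

lemma total_weight_pos:
  assumes "K \<le> card (pverts G)"
  shows "0 < total_weight G \<rho> (configs G K)"
proof -
  obtain \<eta> where "\<eta> \<subseteq> pverts G" "card \<eta> = K"
    using obtain_subset_with_card_n[OF assms] by blast
  then have "\<eta> \<in> configs G K" by (simp add: configs_def)
  then show ?thesis
    unfolding total_weight_def
    by (intro sum_pos finite_configs) (auto simp: configs_def intro: config_weight_pos)
qed

lemma total_weight_at_pos: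
  assumes "0 < K" "K \<le> card (pverts G)" "x \<in> pverts G"
  shows "0 < total_weight G \<rho> (configs_at G K x)"
proof -
  have "K - 1 \<le> card (pverts G - {x})"
    using assms by simp
  then obtain \<eta> where \<eta>: "\<eta> \<subseteq> pverts G - {x}" "card \<eta> = K - 1" "finite \<eta>"
    using obtain_subset_with_card_n by blast
  then have "insert x \<eta> \<in> configs_at G K x"
    using assms by (auto simp: configs_at_def configs_def card_insert_if)
  then show ?thesis
    unfolding total_weight_def using finite_configs[of K]
    by (intro sum_pos) (auto simp: configs_at_def configs_def intro: config_weight_pos)
qed

text \<open>
  Double counting of pairs of a configuration and one of its particles.
\<close>
lemma sum_total_weight_at:
  "(\<Sum>x\<in>pverts G. total_weight G \<rho> (configs_at G K x)) = real K * total_weight G \<rho> (configs G K)"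
proof -
  have "(\<Sum>x\<in>pverts G. total_weight G \<rho> (configs_at G K x))
      = (\<Sum>x\<in>pverts G. \<Sum>\<eta>\<in>{\<eta> \<in> configs G K. x \<in> \<eta>}. config_weight G \<rho> \<eta>)"
    by (simp add: total_weight_def configs_at_def)
  also have "\<dots> = (\<Sum>\<eta>\<in>configs G K. \<Sum>x\<in>{x \<in> pverts G. x \<in> \<eta>}. config_weight G \<rho> \<eta>)"
    by (rule sum.swap_restrict[OF pair_finite_verts finite_configs])
  also have "\<dots> = (\<Sum>\<eta>\<in>configs G K. real K * config_weight G \<rho> \<eta>)"
  proof (intro sum.cong refl)
    fix \<eta> assume "\<eta> \<in> configs G K"
    then have "{x \<in> pverts G. x \<in> \<eta>} = \<eta>" "card \<eta> = K"
      by (auto simp: configs_def)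
    then show "(\<Sum>x\<in>{x \<in> pverts G. x \<in> \<eta>}. config_weight G \<rho> \<eta>) = real K * config_weight G \<rho> \<eta>"
      by simp
  qed
  finally show ?thesis
    by (simp add: total_weight_def sum_distrib_left)
qed

definition occupation :: "nat \<Rightarrow> 'v \<Rightarrow> real" where
  "occupation K x = total_weight G \<rho> (configs_at G K x) / total_weight G \<rho> (configs G K)"

lemma occupation_characterization:
  assumes "0 < K" "K \<le> card (pverts G)"
  shows "(\<forall>x\<in>pverts G. \<forall>y\<in>pverts G.
        r x / r y = total_weight G \<rho> (configs_at G K x) / total_weight G \<rho> (configs_at G K y)) \<and>
      (\<Sum>z\<in>pverts G. r z) = real K \<longleftrightarrow> (\<forall>x\<in>pverts G. r x = occupation K x)"
    (is "?ratios \<and> ?sum \<longleftrightarrow> ?values")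
proof
  let ?a = "\<lambda>x. total_weight G \<rho> (configs_at G K x)" and ?Z = "total_weight G \<rho> (configs G K)"
  have a_pos: "0 < ?a x" if "x \<in> pverts G" for x
    using total_weight_at_pos assms that by blast
  have Z_pos: "0 < ?Z" using total_weight_pos assms by blast
  {
    assume ?values
    have "(\<Sum>z\<in>pverts G. r z) = (\<Sum>z\<in>pverts G. ?a z) / ?Z"
      using \<open>?values\<close> by (simp add: occupation_def sum_divide_distrib)
    also have "\<dots> = real K"
      using Z_pos by (simp add: sum_total_weight_at)
    finally show "?ratios \<and> ?sum"
      using \<open>?values\<close> Z_pos by (simp add: occupation_def)
  next
    assume hyp: "?ratios \<and> ?sum"
    obtain y where y: "y \<in> pverts G"
      using two_vertices by fastforce
    define c where "c = r y / ?a y"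
    have proportional: "r x = c * ?a x" if x: "x \<in> pverts G" for x
    proof -
      have ratio: "r x / r y = ?a x / ?a y" using hyp x y by blast
      moreover have "0 < ?a x / ?a y" using a_pos x y by simp
      \<comment> \<open>Division by zero yields zero, so the positive ratio excludes \<open>r y = 0\<close>.\<close>
      ultimately have "r y \<noteq> 0" by auto
      with ratio show ?thesis using a_pos[OF y] by (simp add: c_def field_simps)
    qed
    have "real K = (\<Sum>z\<in>pverts G. c * ?a z)"
      using conjunct2[OF hyp, symmetric] sum.cong[OF refl proportional, of "pverts G"] by simp
    also have "\<dots> = c * (real K * ?Z)"
      by (simp only: sum_total_weight_at sum_distrib_left[symmetric])
    finally have "c = 1 / ?Z"
      using assms(1) Z_pos by (simp add: field_simps)
    then show ?values
      using proportional by (simp add: occupation_def)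
  }
qed

definition equilibrium :: "nat \<Rightarrow> 'v set \<Rightarrow> real" where
  "equilibrium K \<eta> =
     (if \<eta> \<in> configs G K then config_weight G \<rho> \<eta> / total_weight G \<rho> (configs G K) else 0)"

lemma sum_equilibrium:
  "(\<Sum>\<eta>\<in>{\<eta> \<in> Pow (pverts G). Q \<eta>}. equilibrium K \<eta>) =
    total_weight G \<rho> {\<eta> \<in> configs G K. Q \<eta>} / total_weight G \<rho> (configs G K)"
proof -
  have "(\<Sum>\<eta>\<in>{\<eta> \<in> Pow (pverts G). Q \<eta>}. equilibrium K \<eta>) = (\<Sum>\<eta>\<in>{\<eta> \<in> configs G K. Q \<eta>}. equilibrium K \<eta>)"
    using pair_finite_verts
    by (intro sum.mono_neutral_right) (auto simp: equilibrium_def configs_def)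
  also have "\<dots> = total_weight G \<rho> {\<eta> \<in> configs G K. Q \<eta>} / total_weight G \<rho> (configs G K)"
    by (simp add: equilibrium_def total_weight_def sum_divide_distrib)
  finally show ?thesis .
qed

theorem occupation_limit_from_config:
  assumes "simple_exclusion_process G \<rho> M X" "\<eta> \<in> configs G K"
    and start: "\<P>(\<omega> in M. X 0 \<omega> = \<eta>) > 0"
  shows "((\<lambda>t. \<P>(\<omega> in M. x \<in> X t \<omega> \<bar> X 0 \<omega> = \<eta>)) \<longlongrightarrow> occupation K x) at_top"
proof -
  interpret markov_chain M "Pow (pverts G)" "exclusion_rate G \<rho>" X
    using assms(1) by (simp add: simple_exclusion_process_def)
  have "K \<le> card (pverts G)"
    using assms(2) pair_finite_verts by (auto simp: configs_def intro: card_mono)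
  then have Z_pos: "0 < total_weight G \<rho> (configs G K)"
    by (rule total_weight_pos)
  have support: "0 < equilibrium K \<zeta> \<longleftrightarrow> \<zeta> \<in> configs G K" for \<zeta>
    using Z_pos config_weight_pos by (auto simp: equilibrium_def configs_def)
  have "((\<lambda>t. \<P>(\<omega> in M. x \<in> X t \<omega> \<bar> X 0 \<omega> = \<eta>))
      \<longlongrightarrow> (\<Sum>\<xi>\<in>{\<xi> \<in> Pow (pverts G). x \<in> \<xi>}. equilibrium K \<xi>)) at_top"
  proof (rule cond_prob_tendsto_stationary)
    show "0 \<le> equilibrium K \<zeta>" for \<zeta>
      using support[of \<zeta>] by (auto simp: equilibrium_def)
    show "(\<Sum>\<zeta>\<in>Pow (pverts G). equilibrium K \<zeta>) = 1"
      using sum_equilibrium[where Q = "\<lambda>_. True" and K = K] Z_pos by (simp add: Pow_def)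
    show "equilibrium K \<zeta> * exclusion_rate G \<rho> \<zeta> \<xi> = equilibrium K \<xi> * exclusion_rate G \<rho> \<xi> \<zeta>"
      if "\<zeta> \<in> Pow (pverts G)" "\<xi> \<in> Pow (pverts G)" for \<zeta> \<xi>
    proof (cases "\<zeta> \<in> configs G K \<longleftrightarrow> \<xi> \<in> configs G K")
      case True
      then show ?thesis
        using detailed_balance[of \<zeta> \<xi>] that by (auto simp: equilibrium_def)
    next
      case False
      then show ?thesis
        using exclusion_rate_conserves_card[of \<zeta> \<xi> K] exclusion_rate_conserves_card[of \<xi> \<zeta> K] that
        by (metis PowD mult_zero_right)
    qed
    show "(\<zeta>, \<xi>) \<in> {(\<zeta>, \<xi>). \<zeta> \<in> Pow (pverts G) \<and> \<xi> \<in> Pow (pverts G) \<and> 0 < exclusion_rate G \<rho> \<zeta> \<xi>}\<^sup>*"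
      if "0 < equilibrium K \<zeta>" "0 < equilibrium K \<xi>" for \<zeta> \<xi>
      using configs_communicate[of \<zeta> K \<xi>] that
      unfolding support possible_jumps_def by blast
  qed (use assms support in \<open>auto simp: configs_def\<close>)
  then show ?thesis
    by (simp only: sum_equilibrium occupation_def configs_at_def)
qed

theorem occupation_limit_from_card:
  assumes "simple_exclusion_process G \<rho> M X"
    and "\<P>(\<omega> in M. card (X 0 \<omega>) = K) > 0"
  shows "((\<lambda>t. \<P>(\<omega> in M. x \<in> X t \<omega> \<bar> card (X 0 \<omega>) = K)) \<longlongrightarrow> occupation K x) at_top"
proof -
  interpret markov_chain M "Pow (pverts G)" "exclusion_rate G \<rho>" X
    using assms(1) by (simp add: simple_exclusion_process_def)
  show ?thesis
    by (rule cond_prob_tendsto_of_initial_states[where I = "\<lambda>\<eta>. card \<eta> = K" and Q = "\<lambda>\<xi>. x \<in> \<xi>"])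
      (use assms in \<open>auto intro: occupation_limit_from_config simp: configs_def\<close>)
qed

end

theorem theorem1:
  fixes G :: "'v pair_pre_digraph" and \<rho> :: "'v \<Rightarrow> real"
  assumes "pair_graph G"
    and "Digraph_Component.connected (with_proj G)"
    and "card (pverts G) \<ge> 2"
    and "\<And>x. x \<in> pverts G \<Longrightarrow> \<rho> x > 0"
  shows "\<exists>p :: nat \<Rightarrow> 'v \<Rightarrow> real. \<forall>K. 0 < K \<and> K \<le> card (pverts G) \<longrightarrow>
    (\<forall>(M :: 'w measure) X. simple_exclusion_process G \<rho> M X \<longrightarrow>
       (\<P>(\<omega> in M. card (X 0 \<omega>) = K) > 0 \<longrightarrow>
          (\<forall>x \<in> pverts G.
             ((\<lambda>t. \<P>(\<omega> in M. x \<in> X t \<omega> \<bar> card (X 0 \<omega>) = K)) \<longlongrightarrow> p K x) at_top)) \<and>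
       (\<forall>\<eta> \<in> configs G K. \<P>(\<omega> in M. X 0 \<omega> = \<eta>) > 0 \<longrightarrow>
          (\<forall>x \<in> pverts G.
             ((\<lambda>t. \<P>(\<omega> in M. x \<in> X t \<omega> \<bar> X 0 \<omega> = \<eta>)) \<longlongrightarrow> p K x) at_top))) \<and>
    (\<forall>x \<in> pverts G.
       p K x = total_weight G \<rho> (configs_at G K x) / total_weight G \<rho> (configs G K)) \<and>
    (\<forall>r :: 'v \<Rightarrow> real.
       (\<forall>x \<in> pverts G. \<forall>y \<in> pverts G.
          r x / r y = total_weight G \<rho> (configs_at G K x) / total_weight G \<rho> (configs_at G K y)) \<and>
       (\<Sum>z \<in> pverts G. r z) = real K
       \<longleftrightarrow> (\<forall>x \<in> pverts G. r x = p K x))"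
proof -
  interpret weighted_connected_graph G \<rho>
    using assms by (intro weighted_connected_graph.intro weighted_connected_graph_axioms.intro)
  show ?thesis
  proof (intro exI[of _ occupation] allI impI conjI)
    fix K assume K: "0 < K \<and> K \<le> card (pverts G)"
    fix M :: "'w measure" and X
    assume X: "simple_exclusion_process G \<rho> M X"
    show "\<forall>x\<in>pverts G.
        ((\<lambda>t. \<P>(\<omega> in M. x \<in> X t \<omega> \<bar> card (X 0 \<omega>) = K)) \<longlongrightarrow> occupation K x) at_top"
      if "\<P>(\<omega> in M. card (X 0 \<omega>) = K) > 0"
      using occupation_limit_from_card[OF X that] by blast
    show "\<forall>\<eta>\<in>configs G K. \<P>(\<omega> in M. X 0 \<omega> = \<eta>) > 0 \<longrightarrow> (\<forall>x\<in>pverts G.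
        ((\<lambda>t. \<P>(\<omega> in M. x \<in> X t \<omega> \<bar> X 0 \<omega> = \<eta>)) \<longlongrightarrow> occupation K x) at_top)"
      using occupation_limit_from_config[OF X] by blast
  next
    fix K assume "0 < K \<and> K \<le> card (pverts G)"
    show "\<forall>x\<in>pverts G. occupation K x =
        total_weight G \<rho> (configs_at G K x) / total_weight G \<rho> (configs G K)"
      by (simp add: occupation_def)
  next
    fix K and r :: "'v \<Rightarrow> real" assume "0 < K \<and> K \<le> card (pverts G)"
    then show "((\<forall>x\<in>pverts G. \<forall>y\<in>pverts G.
          r x / r y = total_weight G \<rho> (configs_at G K x) / total_weight G \<rho> (configs_at G K y)) \<and>
        (\<Sum>z\<in>pverts G. r z) = real K) \<longleftrightarrow> (\<forall>x\<in>pverts G. r x = occupation K x)"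
      using occupation_characterization by blast
  qed
qed

end
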